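(* A sequent $\Gamma \vdash \Delta$ is derivable in $\mathrm{ILS}_{\mathrm{BBI}}$ if and only if it is derivable in $\mathrm{IILS}_{\mathrm{BBI}}$ (where, in $\mathrm{IILS}_{\mathrm{BBI}}$, the sequent is written $\mathcal{G}\,||\,\Gamma' \vdash \Delta$ with $\mathcal{G}$ the relational atoms of $\Gamma$ and $\Gamma'$ its labelled formulae).
   Context: BBI formulae: $A ::= p \mid \top \mid \bot \mid \neg A \mid A\lor A \mid A\land A \mid A\to A \mid \top^* \mid A \ast A \mid A \mathrel{-\!\!\ast} A$. Labels are label variables or the constant $\epsilon$; a labelled formula is $w:A$, a relational atom is $(x,y\triangleright z)$. A sequent $\Gamma\vdash\Delta$ has $\Gamma$ a multiset (separated by ";") of labelled formulae and relational atoms and $\Delta$ a multiset of labelled formulae. The calculus $\mathrm{LS}_{\mathrm{BBI}}$ has rules (premises $\Rightarrow$ conclusion; $P$ atomic): id: $\Gamma;w:P\vdash w:P;\Delta$. $\bot L$: $\Gamma;w:\bot\vdash\Delta$. $\top R$: $\Gamma\vdash w:\top;\Delta$. $\top^*R$: $\Gamma\vdash\epsilon:\top^*;\Delta$. $\top^*L$: $\Gamma[\epsilon/w]\vdash\Delta[\epsilon/w] \Rightarrow \Gamma;w:\top^*\vdash\Delta$ ($w\neq\epsilon$). $\land L,\land R,\to L,\to R$: the classical rules with the same label throughout. $\ast L$: $(x,y\triangleright z);\Gamma;x:A;y:B\vdash\Delta \Rightarrow \Gamma;z:A\ast B\vdash\Delta$ ($x,y$ fresh). $\mathrel{-\!\!\ast}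 R$: $(x,y\triangleright z);\Gamma;x:A\vdash z:B;\Delta \Rightarrow \Gamma\vdash y:A\mathrel{-\!\!\ast} B;\Delta$ ($x,z$ fresh). $\ast R$: $(x,y\triangleright z);\Gamma\vdash x:A;z:A\ast B;\Delta$ and $(x,y\triangleright z);\Gamma\vdash y:B;z:A\ast B;\Delta \Rightarrow (x,y\triangleright z);\Gamma\vdash z:A\ast B;\Delta$. $\mathrel{-\!\!\ast} L$: $(x,y\triangleright z);\Gamma;y:A\mathrel{-\!\!\ast} B\vdash x:A;\Delta$ and $(x,y\triangleright z);\Gamma;y:A\mathrel{-\!\!\ast} B;z:B\vdash\Delta \Rightarrow (x,y\triangleright z);\Gamma;y:A\mathrel{-\!\!\ast} B\vdash\Delta$. Structural rules: $E$: $(y,x\triangleright z);(x,y\triangleright z);\Gamma\vdash\Delta\Rightarrow(x,y\triangleright z);\Gamma\vdash\Delta$. $A$: $(u,w\triangleright z);(y,v\triangleright w);(x,y\triangleright z);(u,v\triangleright x);\Gamma\vdash\Delta\Rightarrow(x,y\triangleright z);(u,v\triangleright x);\Gamma\vdash\Delta$ ($w$ fresh). $U$: $(x,\epsilon\triangleright x);\Gamma\vdash\Delta\Rightarrow\Gamma\vdash\Delta$. $A_C$: $(x,w\triangleright x);(y,y\triangleright w);(x,y\triangleright x);\Gamma\vdash\Delta\Rightarrow(x,y\triangleright x);\Gamma\vdash\Delta$ ($w$ fresh). $Eq_1$: $(\epsilon,w'\triangleright w');\Gamma[w'/w]\vdash\Delta[w'/w]\Rightarrow(\epsilon,w\triangleright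 w');\Gamma\vdash\Delta$. $Eq_2$: $(\epsilon,w'\triangleright w');\Gamma[w'/w]\vdash\Delta[w'/w]\Rightarrow(\epsilon,w'\triangleright w);\Gamma\vdash\Delta$ (in both $w\neq\epsilon$). For an instance $r$ of a structural rule with set of principal relational atoms $\mathcal{G}'$ and substitution $\theta$ (identity except for $Eq_1,Eq_2$, where it is $[w'/w]$), $r(\mathcal{G}',\theta)$ is the set of relational atoms introduced in the premise. For a sequence $\sigma$ of such instances: $\mathcal{S}(\mathcal{G},[\,])=\mathcal{G}$; $\mathcal{S}(\mathcal{G},[r(\mathcal{G}',\theta);\sigma'])=\mathcal{S}(\mathcal{G}\theta\cup r(\mathcal{G}',\theta),\sigma')$ if $\mathcal{G}'\subseteq\mathcal{G}$; undefined otherwise. $\mathit{subst}(\sigma)$ is the composition of the substitutions of $\sigma$. $\mathcal{G}\vdash_E(u=v)$ holds iff there is a sequence $\sigma$ of $Eq_1/Eq_2$ instances with $\mathcal{S}(\mathcal{G},\sigma)$ defined and $u\theta=v\theta$ for $\theta=\mathit{subst}(\sigma)$. $\mathcal{G}\vdash_R(w_1=w_2)$ holds iff there is a sequence $\sigma$ of $E,U,A,A_C$ instances with $\mathcal{S}(\mathcal{G},\sigma)\vdash_E(w_1=w_2)$; $\mathcal{G}\vdash_R(w_1,w_2\triangleright w_3)$ holds iff there is such a $\sigma$ and some $(w_1',w_2'\triangleright w_3')\in\mathcal{S}(\mathcal{G},\sigma)$ with $\mathcal{S}(\mathcal{G},\sigma)\vdash_E(w_i=w_i')$ for $i=1,2,3$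 ($\sigma$ is then called a derivation of the entailment). $\mathrm{ILS}_{\mathrm{BBI}}$ is $\mathrm{LS}_{\mathrm{BBI}}$ without $Eq_1,Eq_2$, where (with $\mathcal{G}$ the relational atoms of the conclusion) the following rules are replaced: id: $\Gamma;w_1:P\vdash w_2:P;\Delta$ provided $\mathcal{G}\vdash_E(w_1=w_2)$; $\top^*L$: $(\epsilon,w\triangleright\epsilon);\Gamma\vdash\Delta\Rightarrow\Gamma;w:\top^*\vdash\Delta$; $\top^*R$: $\Gamma\vdash w:\top^*;\Delta$ provided $\mathcal{G}\vdash_E(w=\epsilon)$; $\ast R$ as before but with principal atom $(x,y\triangleright z')$ and conclusion $(x,y\triangleright z');\Gamma\vdash z:A\ast B;\Delta$, provided $\mathcal{G}\vdash_E(z=z')$; $\mathrel{-\!\!\ast} L$ as before but with principal atom $(x,y'\triangleright z)$ and formula $y:A\mathrel{-\!\!\ast} B$, provided $\mathcal{G}\vdash_E(y=y')$; $A$ with atoms $(x,y\triangleright z);(u,v\triangleright x')$ in the conclusion, provided $\mathcal{G}\vdash_E(x=x')$; $A_C$ with atom $(x,y\triangleright x')$, premise $(x,w\triangleright x');(y,y\triangleright w);(x,y\triangleright x');\Gamma\vdash\Delta$, provided $\mathcal{G}\vdash_E(x=x')$. $\mathrm{IILS}_{\mathrm{BBI}}$ uses sequents $\mathcal{G}\,||\,\Gamma\vdash\Delta$ ($\mathcal{G}$ relational atoms, $\Gamma$ labelled formulae). It is $\mathrm{ILS}_{\mathrm{BBI}}$ without the structural rules $E,U,A,A_C$, with the following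 rules changed: id: $\mathcal{G}||\Gamma;w_1:P\vdash w_2:P;\Delta$ provided $\mathcal{G}\vdash_R(w_1=w_2)$; $\top^*R$: $\mathcal{G}||\Gamma\vdash w:\top^*;\Delta$ provided $\mathcal{G}\vdash_R(w=\epsilon)$; $\ast R$: $\mathcal{S}(\mathcal{G},\sigma)||\Gamma\vdash x:A;w:A\ast B;\Delta$ and $\mathcal{S}(\mathcal{G},\sigma)||\Gamma\vdash y:B;w:A\ast B;\Delta\Rightarrow\mathcal{G}||\Gamma\vdash w:A\ast B;\Delta$, where $\sigma$ is a derivation of $\mathcal{G}\vdash_R(x,y\triangleright w)$; $\mathrel{-\!\!\ast} L$: $\mathcal{S}(\mathcal{G},\sigma)||\Gamma;w:A\mathrel{-\!\!\ast} B\vdash x:A;\Delta$ and $\mathcal{S}(\mathcal{G},\sigma)||\Gamma;w:A\mathrel{-\!\!\ast} B;z:B\vdash\Delta\Rightarrow\mathcal{G}||\Gamma;w:A\mathrel{-\!\!\ast} B\vdash\Delta$, where $\sigma$ is a derivation of $\mathcal{G}\vdash_R(x,w\triangleright z)$. The remaining rules are those of $\mathrm{ILS}_{\mathrm{BBI}}$, with new relational atoms added to $\mathcal{G}$. *)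

theory Defs
  imports "HOL-Library.Multiset"
begin

datatype label = Eps | Var nat

(* Neg and Or belong to the language, but the calculi have no rules for them. *)
datatype 'p form =
    Atom 'p
  | Top
  | Bot
  | Neg "'p form"
  | Or "'p form" "'p form"
  | And "'p form" "'p form"
  | Imp "'p form" "'p form"
  | Emp
  | Star "'p form" "'p form"
  | Wand "'p form" "'p form"

(* (x, y, z) stands for the relational atom  x, y |> z. *)
type_synonym rel = "label \<times> label \<times> label"

type_synonym 'p lform = "label \<times> 'p form"

datatype 'p entry = is_Rel: Rel (rel_of: rel) | Fm (fm_of: "'p lform")

definition rels :: "'p entry multiset \<Rightarrow> rel set" where
  "rels \<Gamma> = {a. Rel a \<in># \<Gamma>}"

definition forms :: "'p entry multiset \<Rightarrow> 'p lform multiset" where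
  "forms \<Gamma> = image_mset fm_of (filter_mset (\<lambda>e. \<not> is_Rel e) \<Gamma>)"

definition rel_labels :: "rel set \<Rightarrow> label set" where
  "rel_labels \<G> = (\<Union>(x, y, z)\<in>\<G>. {x, y, z})"

definition form_labels :: "'p lform multiset \<Rightarrow> label set" where
  "form_labels \<Gamma> = fst ` set_mset \<Gamma>"

definition labels :: "'p entry multiset \<Rightarrow> 'p lform multiset \<Rightarrow> label set" where
  "labels \<Gamma> \<Delta> = rel_labels (rels \<Gamma>) \<union> form_labels (forms \<Gamma>) \<union> form_labels \<Delta>"

definition fresh :: "label \<Rightarrow> label set \<Rightarrow> bool" where
  "fresh w L \<longleftrightarrow> w \<noteq> Eps \<and> w \<notin> L"


section \<open>Sequences of structural rule instances\<close>

(* In RA and RAC the label x' is the one that is only required to be provably equal to x,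
   and w is the label created by the rule. *)
datatype inst =
    RE label label label               (* x y z *)
  | RU label                           (* x *)
  | RA label label label label label label label  (* x y z u v x' w *)
  | RAC label label label label        (* x y x' w *)
  | REq1 label label                   (* w w' *)
  | REq2 label label                   (* w w' *)

fun principal :: "inst \<Rightarrow> rel set" where
  "principal (RE x y z) = {(x, y, z)}"
| "principal (RU x) = {}"
| "principal (RA x y z u v x' w) = {(x, y, z), (u, v, x')}"
| "principal (RAC x y x' w) = {(x, y, x')}"
| "principal (REq1 w w') = {(Eps, w, w')}"
| "principal (REq2 w w') = {(Eps, w', w)}"

fun introduced :: "inst \<Rightarrow> rel set" where
  "introduced (RE x y z) = {(y, x, z)}"
| "introduced (RU x) = {(x, Eps, x)}"
| "introduced (RA x y z u v x' w) = {(u, w, z), (y, v, w)}"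
| "introduced (RAC x y x' w) = {(x, w, x'), (y, y, w)}"
| "introduced (REq1 w w') = {(Eps, w', w')}"
| "introduced (REq2 w w') = {(Eps, w', w')}"

fun inst_subst :: "inst \<Rightarrow> label \<Rightarrow> label" where
  "inst_subst (REq1 w w') = id(w := w')"
| "inst_subst (REq2 w w') = id(w := w')"
| "inst_subst _ = id"

definition subst_rels :: "(label \<Rightarrow> label) \<Rightarrow> rel set \<Rightarrow> rel set" where
  "subst_rels \<theta> \<G> = (\<lambda>(x, y, z). (\<theta> x, \<theta> y, \<theta> z)) ` \<G>"

definition apply_inst :: "rel set \<Rightarrow> inst \<Rightarrow> rel set" where
  "apply_inst \<G> r = subst_rels (inst_subst r) \<G> \<union> introduced r"

fun apply_seq :: "rel set \<Rightarrow> inst list \<Rightarrow> rel set option" where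
  "apply_seq \<G> [] = Some \<G>"
| "apply_seq \<G> (r # \<sigma>) =
     (if principal r \<subseteq> \<G> then apply_seq (apply_inst \<G> r) \<sigma> else None)"

fun seq_subst :: "inst list \<Rightarrow> label \<Rightarrow> label" where
  "seq_subst [] = id"
| "seq_subst (r # \<sigma>) = seq_subst \<sigma> \<circ> inst_subst r"

fun eq_inst :: "inst \<Rightarrow> bool" where
  "eq_inst (REq1 w w') \<longleftrightarrow> w \<noteq> Eps"
| "eq_inst (REq2 w w') \<longleftrightarrow> w \<noteq> Eps"
| "eq_inst _ \<longleftrightarrow> False"

definition entails_E :: "rel set \<Rightarrow> label \<Rightarrow> label \<Rightarrow> bool" where
  "entails_E \<G> u v \<longleftrightarrow>
     (\<exists>\<sigma>. list_all eq_inst \<sigma> \<and> apply_seq \<G> \<sigma> \<noteq> None \<and> seq_subst \<sigma> u = seq_subst \<sigma> v)"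

(* Side conditions of E, U, A, A_C on a sequent with relational atoms \<G>. The set L holds the
   labels of the labelled formulae of that sequent: the label created by A or A_C must be fresh
   for the whole sequent, not just for \<G>. *)
fun struct_inst :: "label set \<Rightarrow> rel set \<Rightarrow> inst \<Rightarrow> bool" where
  "struct_inst L \<G> (RE x y z) \<longleftrightarrow> True"
| "struct_inst L \<G> (RU x) \<longleftrightarrow> True"
| "struct_inst L \<G> (RA x y z u v x' w) \<longleftrightarrow>
     entails_E \<G> x x' \<and> fresh w (L \<union> rel_labels \<G>)"
| "struct_inst L \<G> (RAC x y x' w) \<longleftrightarrow>
     entails_E \<G> x x' \<and> fresh w (L \<union> rel_labels \<G>)"
| "struct_inst L \<G> (REq1 w w') \<longleftrightarrow> False"
| "struct_inst L \<G> (REq2 w w') \<longleftrightarrow> False"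

fun struct_seq :: "label set \<Rightarrow> rel set \<Rightarrow> inst list \<Rightarrow> bool" where
  "struct_seq L \<G> [] \<longleftrightarrow> True"
| "struct_seq L \<G> (r # \<sigma>) \<longleftrightarrow> struct_inst L \<G> r \<and> struct_seq L (apply_inst \<G> r) \<sigma>"

definition entails_R_eq :: "label set \<Rightarrow> rel set \<Rightarrow> label \<Rightarrow> label \<Rightarrow> bool" where
  "entails_R_eq L \<G> w1 w2 \<longleftrightarrow>
     (\<exists>\<sigma> \<H>. struct_seq L \<G> \<sigma> \<and> apply_seq \<G> \<sigma> = Some \<H> \<and> entails_E \<H> w1 w2)"

(* \<sigma> is a derivation of the entailment of  w1, w2 |> w3  by \<G>, and \<H> is its result. *)
definition derivation_R ::
    "label set \<Rightarrow> rel set \<Rightarrow> inst list \<Rightarrow> rel \<Rightarrow> rel set \<Rightarrow> bool" where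
  "derivation_R L \<G> \<sigma> = (\<lambda>(w1, w2, w3) \<H>.
     struct_seq L \<G> \<sigma> \<and> apply_seq \<G> \<sigma> = Some \<H> \<and>
     (\<exists>(w1', w2', w3')\<in>\<H>. entails_E \<H> w1 w1' \<and> entails_E \<H> w2 w2' \<and> entails_E \<H> w3 w3'))"


section \<open>The calculi\<close>

inductive ILS :: "'p entry multiset \<Rightarrow> 'p lform multiset \<Rightarrow> bool" where
  ident: "entails_E (rels (add_mset (Fm (w1, Atom p)) \<Gamma>)) w1 w2 \<Longrightarrow>
    ILS (add_mset (Fm (w1, Atom p)) \<Gamma>) (add_mset (w2, Atom p) \<Delta>)"
| BotL: "ILS (add_mset (Fm (w, Bot)) \<Gamma>) \<Delta>"
| TopR: "ILS \<Gamma> (add_mset (w, Top) \<Delta>)"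
| EmpL: "ILS (add_mset (Rel (Eps, w, Eps)) \<Gamma>) \<Delta> \<Longrightarrow>
    ILS (add_mset (Fm (w, Emp)) \<Gamma>) \<Delta>"
| EmpR: "entails_E (rels \<Gamma>) w Eps \<Longrightarrow> ILS \<Gamma> (add_mset (w, Emp) \<Delta>)"
| AndL: "ILS (\<Gamma> + {#Fm (w, A), Fm (w, B)#}) \<Delta> \<Longrightarrow>
    ILS (add_mset (Fm (w, And A B)) \<Gamma>) \<Delta>"
| AndR: "ILS \<Gamma> (add_mset (w, A) \<Delta>) \<Longrightarrow> ILS \<Gamma> (add_mset (w, B) \<Delta>) \<Longrightarrow>
    ILS \<Gamma> (add_mset (w, And A B) \<Delta>)"
| ImpL: "ILS \<Gamma> (add_mset (w, A) \<Delta>) \<Longrightarrow> ILS (add_mset (Fm (w, B)) \<Gamma>) \<Delta> \<Longrightarrow>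
    ILS (add_mset (Fm (w, Imp A B)) \<Gamma>) \<Delta>"
| ImpR: "ILS (add_mset (Fm (w, A)) \<Gamma>) (add_mset (w, B) \<Delta>) \<Longrightarrow>
    ILS \<Gamma> (add_mset (w, Imp A B) \<Delta>)"
| StarL: "ILS (\<Gamma> + {#Rel (x, y, z), Fm (x, A), Fm (y, B)#}) \<Delta> \<Longrightarrow>
    fresh x (labels (add_mset (Fm (z, Star A B)) \<Gamma>) \<Delta>) \<Longrightarrow>
    fresh y (labels (add_mset (Fm (z, Star A B)) \<Gamma>) \<Delta>) \<Longrightarrow> x \<noteq> y \<Longrightarrow>
    ILS (add_mset (Fm (z, Star A B)) \<Gamma>) \<Delta>"
| WandR: "ILS (\<Gamma> + {#Rel (x, y, z), Fm (x, A)#}) (add_mset (z, B) \<Delta>) \<Longrightarrow>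
    fresh x (labels \<Gamma> (add_mset (y, Wand A B) \<Delta>)) \<Longrightarrow>
    fresh z (labels \<Gamma> (add_mset (y, Wand A B) \<Delta>)) \<Longrightarrow> x \<noteq> z \<Longrightarrow>
    ILS \<Gamma> (add_mset (y, Wand A B) \<Delta>)"
| StarR: "ILS (add_mset (Rel (x, y, z')) \<Gamma>) (\<Delta> + {#(x, A), (z, Star A B)#}) \<Longrightarrow>
    ILS (add_mset (Rel (x, y, z')) \<Gamma>) (\<Delta> + {#(y, B), (z, Star A B)#}) \<Longrightarrow>
    entails_E (rels (add_mset (Rel (x, y, z')) \<Gamma>)) z z' \<Longrightarrow>
    ILS (add_mset (Rel (x, y, z')) \<Gamma>) (add_mset (z, Star A B) \<Delta>)"
| WandL: "ILS (\<Gamma> + {#Rel (x, y', z), Fm (y, Wand A B)#}) (add_mset (x, A) \<Delta>) \<Longrightarrow>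
    ILS (\<Gamma> + {#Rel (x, y', z), Fm (y, Wand A B), Fm (z, B)#}) \<Delta> \<Longrightarrow>
    entails_E (rels (\<Gamma> + {#Rel (x, y', z), Fm (y, Wand A B)#})) y y' \<Longrightarrow>
    ILS (\<Gamma> + {#Rel (x, y', z), Fm (y, Wand A B)#}) \<Delta>"
| E: "ILS (\<Gamma> + {#Rel (y, x, z), Rel (x, y, z)#}) \<Delta> \<Longrightarrow>
    ILS (add_mset (Rel (x, y, z)) \<Gamma>) \<Delta>"
| U: "ILS (add_mset (Rel (x, Eps, x)) \<Gamma>) \<Delta> \<Longrightarrow> ILS \<Gamma> \<Delta>"
| A: "ILS (\<Gamma> + {#Rel (u, w, z), Rel (y, v, w), Rel (x, y, z), Rel (u, v, x')#}) \<Delta> \<Longrightarrow>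
    entails_E (rels (\<Gamma> + {#Rel (x, y, z), Rel (u, v, x')#})) x x' \<Longrightarrow>
    fresh w (labels (\<Gamma> + {#Rel (x, y, z), Rel (u, v, x')#}) \<Delta>) \<Longrightarrow>
    ILS (\<Gamma> + {#Rel (x, y, z), Rel (u, v, x')#}) \<Delta>"
| AC: "ILS (\<Gamma> + {#Rel (x, w, x'), Rel (y, y, w), Rel (x, y, x')#}) \<Delta> \<Longrightarrow>
    entails_E (rels (add_mset (Rel (x, y, x')) \<Gamma>)) x x' \<Longrightarrow>
    fresh w (labels (add_mset (Rel (x, y, x')) \<Gamma>) \<Delta>) \<Longrightarrow>
    ILS (add_mset (Rel (x, y, x')) \<Gamma>) \<Delta>"

inductive IILS :: "rel set \<Rightarrow> 'p lform multiset \<Rightarrow> 'p lform multiset \<Rightarrow> bool" where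
  ident: "entails_R_eq
      (form_labels (add_mset (w1, Atom p) \<Gamma>) \<union> form_labels (add_mset (w2, Atom p) \<Delta>))
      \<G> w1 w2 \<Longrightarrow>
    IILS \<G> (add_mset (w1, Atom p) \<Gamma>) (add_mset (w2, Atom p) \<Delta>)"
| BotL: "IILS \<G> (add_mset (w, Bot) \<Gamma>) \<Delta>"
| TopR: "IILS \<G> \<Gamma> (add_mset (w, Top) \<Delta>)"
| EmpL: "IILS (insert (Eps, w, Eps) \<G>) \<Gamma> \<Delta> \<Longrightarrow> IILS \<G> (add_mset (w, Emp) \<Gamma>) \<Delta>"
| EmpR: "entails_R_eq (form_labels \<Gamma> \<union> form_labels (add_mset (w, Emp) \<Delta>)) \<G> w Eps \<Longrightarrow>
    IILS \<G> \<Gamma> (add_mset (w, Emp) \<Delta>)"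
| AndL: "IILS \<G> (\<Gamma> + {#(w, A), (w, B)#}) \<Delta> \<Longrightarrow> IILS \<G> (add_mset (w, And A B) \<Gamma>) \<Delta>"
| AndR: "IILS \<G> \<Gamma> (add_mset (w, A) \<Delta>) \<Longrightarrow> IILS \<G> \<Gamma> (add_mset (w, B) \<Delta>) \<Longrightarrow>
    IILS \<G> \<Gamma> (add_mset (w, And A B) \<Delta>)"
| ImpL: "IILS \<G> \<Gamma> (add_mset (w, A) \<Delta>) \<Longrightarrow> IILS \<G> (add_mset (w, B) \<Gamma>) \<Delta> \<Longrightarrow>
    IILS \<G> (add_mset (w, Imp A B) \<Gamma>) \<Delta>"
| ImpR: "IILS \<G> (add_mset (w, A) \<Gamma>) (add_mset (w, B) \<Delta>) \<Longrightarrow>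
    IILS \<G> \<Gamma> (add_mset (w, Imp A B) \<Delta>)"
| StarL: "IILS (insert (x, y, z) \<G>) (\<Gamma> + {#(x, A), (y, B)#}) \<Delta> \<Longrightarrow>
    fresh x (rel_labels \<G> \<union> form_labels (add_mset (z, Star A B) \<Gamma>) \<union> form_labels \<Delta>) \<Longrightarrow>
    fresh y (rel_labels \<G> \<union> form_labels (add_mset (z, Star A B) \<Gamma>) \<union> form_labels \<Delta>) \<Longrightarrow>
    x \<noteq> y \<Longrightarrow>
    IILS \<G> (add_mset (z, Star A B) \<Gamma>) \<Delta>"
| WandR: "IILS (insert (x, y, z) \<G>) (add_mset (x, A) \<Gamma>) (add_mset (z, B) \<Delta>) \<Longrightarrow>
    fresh x (rel_labels \<G> \<union> form_labels \<Gamma> \<union> form_labels (add_mset (y, Wand A B) \<Delta>)) \<Longrightarrow>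
    fresh z (rel_labels \<G> \<union> form_labels \<Gamma> \<union> form_labels (add_mset (y, Wand A B) \<Delta>)) \<Longrightarrow>
    x \<noteq> z \<Longrightarrow>
    IILS \<G> \<Gamma> (add_mset (y, Wand A B) \<Delta>)"
| StarR: "derivation_R (form_labels \<Gamma> \<union> form_labels (add_mset (w, Star A B) \<Delta>))
      \<G> \<sigma> (x, y, w) \<H> \<Longrightarrow>
    IILS \<H> \<Gamma> (\<Delta> + {#(x, A), (w, Star A B)#}) \<Longrightarrow>
    IILS \<H> \<Gamma> (\<Delta> + {#(y, B), (w, Star A B)#}) \<Longrightarrow>
    IILS \<G> \<Gamma> (add_mset (w, Star A B) \<Delta>)"
| WandL: "derivation_R (form_labels (add_mset (w, Wand A B) \<Gamma>) \<union> form_labels \<Delta>)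
      \<G> \<sigma> (x, w, z) \<H> \<Longrightarrow>
    IILS \<H> (add_mset (w, Wand A B) \<Gamma>) (add_mset (x, A) \<Delta>) \<Longrightarrow>
    IILS \<H> (\<Gamma> + {#(w, Wand A B), (z, B)#}) \<Delta> \<Longrightarrow>
    IILS \<G> (add_mset (w, Wand A B) \<Gamma>) \<Delta>"

end

theory Submission
  imports Defs
begin

text \<open>
  Provable equality by \<open>Eq\<^sub>1\<close> and \<open>Eq\<^sub>2\<close> is the least equivalence relation that identifies \<open>a\<close> and
  \<open>b\<close> whenever \<open>(e, a \<triangleright> b)\<close> is an atom and \<open>e\<close> is identified with \<open>\<epsilon>\<close>.  From ILS to IILS, a block of
  structural rules commutes upwards past every logical rule until a zero-premise rule, \<open>\<ast>R\<close> or
  \<open>-\<ast>L\<close> absorbs it into its derivation.  From IILS to ILS, one shows more by induction: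
  the sequent remains derivable in ILS when all labels are replaced by provably equal ones.  This
  slack is needed because \<open>\<ast>R\<close> and \<open>-\<ast>L\<close> of IILS use labels that are only provably equal to those
  of the principal atom.
\<close>

section \<open>Provable equality of labels\<close>

text \<open>The set \<open>\<G>\<close> stays fixed here, whereas each Eq instance rewrites it.
  Requiring the first label only to be provably equal to \<open>Eps\<close> accounts for atoms that
  begin with \<open>Eps\<close> only after earlier substitutions.\<close>

inductive eq_closure :: "rel set \<Rightarrow> label \<Rightarrow> label \<Rightarrow> bool" for \<G> where
  refl [simp, intro]: "eq_closure \<G> a a"
| sym: "eq_closure \<G> a b \<Longrightarrow> eq_closure \<G> b a"
| trans: "eq_closure \<G> a b \<Longrightarrow> eq_closure \<G> b c \<Longrightarrow> eq_closure \<G> a c"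
| unit: "(e, a, b) \<in> \<G> \<Longrightarrow> eq_closure \<G> e Eps \<Longrightarrow> eq_closure \<G> a b"

text \<open>A weakening of inclusion that tolerates replacing labels by provably equal ones.
  Equalities are taken in the covering set \<open>\<H>\<close>, so enlarging \<open>\<H>\<close>
  preserves the property.\<close>

definition covers :: "rel set \<Rightarrow> rel set \<Rightarrow> bool" where
  "covers \<H> \<G> \<longleftrightarrow> (\<forall>x y z. (x, y, z) \<in> \<G> \<longrightarrow> (\<exists>x' y' z'. (x', y', z') \<in> \<H> \<and>
     eq_closure \<H> x x' \<and> eq_closure \<H> y y' \<and> eq_closure \<H> z z'))"

lemma coversE:
  assumes "covers \<H> \<G>" "(x, y, z) \<in> \<G>"
  obtains x' y' z' where "(x', y', z') \<in> \<H>"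
    "eq_closure \<H> x x'" "eq_closure \<H> y y'" "eq_closure \<H> z z'"
  using assms unfolding covers_def by blast

lemma covers_subset: "\<G> \<subseteq> \<H> \<Longrightarrow> covers \<H> \<G>"
  unfolding covers_def by blast

text \<open>Atoms matter only in case \<open>unit\<close>. There the first label of the counterpart
  is equal to \<open>e\<close> in \<open>\<H>\<close>, hence to \<open>Eps\<close>, so the
  counterpart equates its last two labels, which in turn are equal to \<open>a\<close> and
  \<open>b\<close>.\<close>

lemma eq_closure_covers:
  assumes "eq_closure \<G> a b" "covers \<H> \<G>"
  shows "eq_closure \<H> a b"
  using assms(1)
proof induction
  case (unit e a b)
  from assms(2) unit.hyps(1) obtain e' a' b' where im: "(e', a', b') \<in> \<H>"
    "eq_closure \<H> e e'" "eq_closure \<H> a a'" "eq_closure \<H> b b'"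
    by (rule coversE)
  have "eq_closure \<H> e' Eps"
    using im(2) unit.IH eq_closure.sym eq_closure.trans by blast
  with im(1) have "eq_closure \<H> a' b'" by (rule eq_closure.unit)
  then show ?case using im(3,4) eq_closure.sym eq_closure.trans by blast
qed (auto intro: eq_closure.sym eq_closure.trans)

lemma eq_closure_mono: "eq_closure \<G> a b \<Longrightarrow> \<G> \<subseteq> \<H> \<Longrightarrow> eq_closure \<H> a b"
  by (simp add: eq_closure_covers covers_subset)

lemma covers_mono: "covers \<H> \<G> \<Longrightarrow> \<H> \<subseteq> \<H>' \<Longrightarrow> covers \<H>' \<G>"
  unfolding covers_def by (meson eq_closure_mono subsetD)

lemma covers_insert:
  assumes "covers \<H> \<G>" "(x', y', z') \<in> \<H>"
    "eq_closure \<H> x x'" "eq_closure \<H> y y'" "eq_closure \<H> z z'"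
  shows "covers \<H> (insert (x, y, z) \<G>)"
  using assms unfolding covers_def by blast

text \<open>The replaced label and its replacement are the last two labels of a principal atom that
  begins with \<open>Eps\<close>, so rule \<open>unit\<close> equates them.\<close>

lemma eq_closure_inst_subst:
  assumes "eq_inst r" "principal r \<subseteq> \<G>"
  shows "eq_closure \<G> a (inst_subst r a)"
  using assms
  by (cases r) (auto, (blast intro: eq_closure.unit eq_closure.sym)+)

text \<open>The covering runs backwards, from the set before the step to the set after it: renamed
  atoms differ from their originals by equal labels, and the introduced atom is matched by the
  principal one. So an Eq step makes no new equality provable.\<close>

lemma covers_apply_inst:
  assumes "eq_inst r" "principal r \<subseteq> \<G>"
  shows "covers \<G> (apply_inst \<G> r)"
proof -
  note step = eq_closure_inst_subst[OF assms]
  have "\<exists>x' y' z'. (x', y', z') \<in> \<G> \<and>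
      eq_closure \<G> x x' \<and> eq_closure \<G> y y' \<and> eq_closure \<G> z z'"
    if "(x, y, z) \<in> apply_inst \<G> r" for x y z
    using that unfolding apply_inst_def
  proof
    assume "(x, y, z) \<in> subst_rels (inst_subst r) \<G>"
    then show ?thesis
      using step eq_closure.sym unfolding subst_rels_def by fastforce
  next
    assume "(x, y, z) \<in> introduced r"
    then show ?thesis
      using assms by (cases r) (auto, (blast intro: eq_closure.unit eq_closure.sym)+)
  qed
  then show ?thesis unfolding covers_def by blast
qed

text \<open>An equality that holds after the first step is pulled back along
  \<open>covers_apply_inst\<close>, and each label equals its image under the first
  substitution.\<close>

lemma eq_closure_if_seq:
  assumes "list_all eq_inst \<sigma>" "apply_seq \<G> \<sigma> \<noteq> None" "seq_subst \<sigma> u = seq_subst \<sigma> v"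
  shows "eq_closure \<G> u v"
  using assms
proof (induction \<sigma> arbitrary: \<G> u v)
  case (Cons r \<sigma>)
  then have r: "eq_inst r" "principal r \<subseteq> \<G>" by (auto split: if_splits)
  have "eq_closure (apply_inst \<G> r) (inst_subst r u) (inst_subst r v)"
    using Cons by (auto split: if_splits)
  then have "eq_closure \<G> (inst_subst r u) (inst_subst r v)"
    by (rule eq_closure_covers) (rule covers_apply_inst[OF r])
  then show ?case
    using eq_closure_inst_subst[OF r] eq_closure.sym eq_closure.trans by blast
qed auto

section \<open>Realising the closure by sequences of Eq instances\<close>

lemma apply_seq_append:
  "apply_seq \<G> (\<sigma> @ \<tau>) = Option.bind (apply_seq \<G> \<sigma>) (\<lambda>\<H>. apply_seq \<H> \<tau>)"
  by (induction \<sigma> arbitrary: \<G>) auto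

lemma seq_subst_append: "seq_subst (\<sigma> @ \<tau>) = seq_subst \<tau> \<circ> seq_subst \<sigma>"
  by (induction \<sigma>) auto

lemma seq_subst_Eps: "list_all eq_inst \<sigma> \<Longrightarrow> seq_subst \<sigma> Eps = Eps"
proof (induction \<sigma>)
  case (Cons r \<sigma>)
  then show ?case by (cases r) auto
qed auto

lemma apply_seq_subst:
  "apply_seq \<G> \<sigma> = Some \<H> \<Longrightarrow> subst_rels (seq_subst \<sigma>) \<G> \<subseteq> \<H>"
proof (induction \<sigma> arbitrary: \<G>)
  case Nil
  then show ?case by (auto simp: subst_rels_def)
next
  case (Cons r \<sigma>)
  then have "subst_rels (seq_subst \<sigma>) (apply_inst \<G> r) \<subseteq> \<H>"
    by (auto split: if_splits)
  then show ?case by (force simp: subst_rels_def apply_inst_def)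
qed

text \<open>The claim concerns extensions of an arbitrary sequence so that the sequences for the premises
  of transitivity can be concatenated.\<close>

lemma seq_if_eq_closure:
  assumes "eq_closure \<G> u v"
    and "list_all eq_inst \<sigma>" "apply_seq \<G> \<sigma> \<noteq> None"
  shows "\<exists>\<tau>. list_all eq_inst (\<sigma> @ \<tau>) \<and> apply_seq \<G> (\<sigma> @ \<tau>) \<noteq> None \<and>
    seq_subst (\<sigma> @ \<tau>) u = seq_subst (\<sigma> @ \<tau>) v"
  using assms
proof (induction arbitrary: \<sigma>)
  case (refl a)
  then show ?case by (intro exI[of _ "[]"]) auto
next
  case (sym a b)
  then show ?case by metis
next
  case (trans a b c)
  from trans.IH(1)[OF trans.prems] obtain \<tau> where \<tau>: "list_all eq_inst (\<sigma> @ \<tau>)"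
    "apply_seq \<G> (\<sigma> @ \<tau>) \<noteq> None" "seq_subst (\<sigma> @ \<tau>) a = seq_subst (\<sigma> @ \<tau>) b"
    by blast
  from trans.IH(2)[OF \<tau>(1,2)] obtain \<rho> where \<rho>: "list_all eq_inst ((\<sigma> @ \<tau>) @ \<rho>)"
    "apply_seq \<G> ((\<sigma> @ \<tau>) @ \<rho>) \<noteq> None"
    "seq_subst ((\<sigma> @ \<tau>) @ \<rho>) b = seq_subst ((\<sigma> @ \<tau>) @ \<rho>) c"
    by blast
  have "seq_subst ((\<sigma> @ \<tau>) @ \<rho>) a = seq_subst ((\<sigma> @ \<tau>) @ \<rho>) b"
    using \<tau>(3) by (simp add: seq_subst_append[of "\<sigma> @ \<tau>"] del: append_assoc)
  with \<rho> show ?case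
    by (intro exI[of _ "\<tau> @ \<rho>"]) auto
next
  case (unit e a b)
  from unit.IH[OF unit.prems] obtain \<tau> where \<tau>: "list_all eq_inst (\<sigma> @ \<tau>)"
    "apply_seq \<G> (\<sigma> @ \<tau>) \<noteq> None" "seq_subst (\<sigma> @ \<tau>) e = seq_subst (\<sigma> @ \<tau>) Eps"
    by blast
  define \<theta> where "\<theta> = seq_subst (\<sigma> @ \<tau>)"
  from \<tau>(2) obtain \<H> where \<H>: "apply_seq \<G> (\<sigma> @ \<tau>) = Some \<H>" by blast
  \<comment> \<open>Eq instances never replace \<open>Eps\<close>, so \<open>\<theta>\<close> fixes
    it. As \<open>\<theta>\<close> identifies \<open>e\<close> with \<open>Eps\<close>, the image of
    the atom begins with \<open>Eps\<close>.\<close>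
  have "\<theta> e = Eps" using \<tau>(1,3) seq_subst_Eps unfolding \<theta>_def by metis
  with unit.hyps(1) have atom: "(Eps, \<theta> a, \<theta> b) \<in> \<H>"
    using apply_seq_subst[OF \<H>] unfolding \<theta>_def[symmetric] subst_rels_def by force
  show ?case
  proof (cases "\<theta> a = \<theta> b")
    case True
    with \<tau> show ?thesis unfolding \<theta>_def by blast
  next
    case False
    \<comment> \<open>The replaced label must differ from \<open>Eps\<close>. If
      \<open>\<theta> a\<close> is \<open>Eps\<close>, then \<open>\<theta> b\<close> is not, and
      \<open>REq2\<close> replaces that one instead.\<close>
    define r where "r = (if \<theta> a = Eps then REq2 (\<theta> b) (\<theta> a) else REq1 (\<theta> a) (\<theta> b))"
    have r: "eq_inst r" "principal r \<subseteq> \<H>" "inst_subst r (\<theta> a) = inst_subst r (\<theta> b)"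
      using False atom unfolding r_def by auto
    have "apply_seq \<G> ((\<sigma> @ \<tau>) @ [r]) \<noteq> None"
      unfolding apply_seq_append[of _ "\<sigma> @ \<tau>"] \<H> using r(2) by simp
    moreover have "seq_subst ((\<sigma> @ \<tau>) @ [r]) a = seq_subst ((\<sigma> @ \<tau>) @ [r]) b"
      unfolding seq_subst_append[of "\<sigma> @ \<tau>"] \<theta>_def[symmetric] using r(3) by simp
    ultimately show ?thesis
      using \<tau>(1) r(1) by (intro exI[of _ "\<tau> @ [r]"]) auto
  qed
qed

text \<open>Through this characterisation the side conditions on provable equality are monotone in
  the atoms and transitive, so sequences of Eq instances need no further inspection.\<close>

lemma entails_E_iff: "entails_E \<G> u v \<longleftrightarrow> eq_closure \<G> u v"
proof
  assume "entails_E \<G> u v"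
  then show "eq_closure \<G> u v" unfolding entails_E_def using eq_closure_if_seq by blast
next
  assume "eq_closure \<G> u v"
  from seq_if_eq_closure[OF this, of "[]"] show "entails_E \<G> u v"
    unfolding entails_E_def by auto
qed

section \<open>Sequences of structural rules\<close>

lemma apply_inst_struct: "struct_inst L \<G> r \<Longrightarrow> apply_inst \<G> r = \<G> \<union> introduced r"
  by (cases r) (auto simp: apply_inst_def subst_rels_def)

lemma apply_seq_struct_mono:
  "struct_seq L \<G> \<sigma> \<Longrightarrow> apply_seq \<G> \<sigma> = Some \<H> \<Longrightarrow> \<G> \<subseteq> \<H>"
  by (induction \<sigma> arbitrary: \<G>) (force simp: apply_inst_struct split: if_splits)+

lemma struct_seq_append:
  "apply_seq \<G> \<sigma> = Some \<H> \<Longrightarrow>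
   struct_seq L \<G> (\<sigma> @ \<tau>) \<longleftrightarrow> struct_seq L \<G> \<sigma> \<and> struct_seq L \<H> \<tau>"
  by (induction \<sigma> arbitrary: \<G>) (auto split: if_splits)

lemma rel_labels_union [simp]: "rel_labels (\<G> \<union> \<H>) = rel_labels \<G> \<union> rel_labels \<H>"
  unfolding rel_labels_def by blast

lemma rel_labels_insert [simp]:
  "rel_labels (insert (x, y, z) \<G>) = {x, y, z} \<union> rel_labels \<G>"
  unfolding rel_labels_def by auto

lemma rel_labels_empty [simp]: "rel_labels {} = {}"
  unfolding rel_labels_def by simp

lemma rel_labels_mono: "\<G> \<subseteq> \<H> \<Longrightarrow> rel_labels \<G> \<subseteq> rel_labels \<H>"
  unfolding rel_labels_def by blast

lemma form_labels_simps [simp]: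
  "form_labels {#} = {}"
  "form_labels (add_mset (w, A) \<Gamma>) = insert w (form_labels \<Gamma>)"
  "form_labels (\<Gamma> + \<Gamma>') = form_labels \<Gamma> \<union> form_labels \<Gamma>'"
  unfolding form_labels_def by auto

text \<open>Additional atoms preserve provable equalities, so only freshness is at stake. A label
  created by \<open>\<sigma>\<close> occurs in \<open>\<H>\<close> but neither in \<open>L\<close>
  nor in \<open>\<G>\<close>; by the last assumption it then avoids \<open>L'\<close> and
  \<open>\<X>\<close>.\<close>

lemma struct_seq_frame:
  assumes "struct_seq L \<G> \<sigma>" "apply_seq \<G> \<sigma> = Some \<H>"
    and "(L' \<union> rel_labels \<X>) \<inter> rel_labels \<H> \<subseteq> insert Eps (L \<union> rel_labels \<G>)"
  shows "struct_seq L' (\<G> \<union> \<X>) \<sigma> \<and> apply_seq (\<G> \<union> \<X>) \<sigma> = Some (\<H> \<union> \<X>)"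
  using assms
proof (induction \<sigma> arbitrary: \<G>)
  case (Cons r \<sigma>)
  then have r: "struct_inst L \<G> r" "principal r \<subseteq> \<G>"
    and seq: "struct_seq L (apply_inst \<G> r) \<sigma>" "apply_seq (apply_inst \<G> r) \<sigma> = Some \<H>"
    by (auto split: if_splits)
  note ai = apply_inst_struct[OF r(1)]
  have sub: "\<G> \<union> introduced r \<subseteq> \<H>"
    using apply_seq_struct_mono[OF seq] ai by simp
  have "struct_inst L' (\<G> \<union> \<X>) r"
  proof (cases r)
    case (RA x y z u v x' w)
    then have "w \<in> rel_labels \<H>" using rel_labels_mono[OF sub] by auto
    then show ?thesis
      using RA r Cons.prems(3) by (auto simp: entails_E_iff fresh_def intro: eq_closure_mono)
  next
    case (RAC x y x' w)
    then have "w \<in> rel_labels \<H>" using rel_labels_mono[OF sub] by auto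
    then show ?thesis
      using RAC r Cons.prems(3) by (auto simp: entails_E_iff fresh_def intro: eq_closure_mono)
  qed (use r in auto)
  moreover from this have "apply_inst (\<G> \<union> \<X>) r = apply_inst \<G> r \<union> \<X>"
    using apply_inst_struct ai by blast
  \<comment> \<open>A step only enlarges the right-hand side of the label condition, so the
    condition passes to the tail.\<close>
  moreover have "struct_seq L' (apply_inst \<G> r \<union> \<X>) \<sigma> \<and>
      apply_seq (apply_inst \<G> r \<union> \<X>) \<sigma> = Some (\<H> \<union> \<X>)"
    using Cons.prems(3) by (intro Cons.IH seq) (auto simp: ai)
  ultimately show ?case using r(2) by auto
qed auto

text \<open>Concatenating \<open>\<sigma>\<close> with the sequence that witnesses the entailment
  from \<open>\<H>\<close> gives one from \<open>\<G>\<close>. In this way \<open>ident\<close> and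
  \<open>EmpR\<close> absorb a block of structural rules.\<close>

lemma entails_R_eq_struct:
  assumes "struct_seq L \<G> \<sigma>" "apply_seq \<G> \<sigma> = Some \<H>" "entails_R_eq L \<H> u v"
  shows "entails_R_eq L \<G> u v"
proof -
  from assms(3) obtain \<tau> \<K> where "struct_seq L \<H> \<tau>" "apply_seq \<H> \<tau> = Some \<K>"
    "entails_E \<K> u v"
    unfolding entails_R_eq_def by blast
  with assms(1,2) show ?thesis
    unfolding entails_R_eq_def
    by (intro exI[of _ "\<sigma> @ \<tau>"] exI[of _ \<K>]) (auto simp: struct_seq_append apply_seq_append)
qed

text \<open>The block becomes a prefix of the derivation while the resulting set \<open>\<K>\<close>
  stays the same, so the premises of \<open>StarR\<close> and \<open>WandL\<close> can be reused
  unchanged.\<close>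

lemma derivation_R_struct:
  assumes "struct_seq L \<G> \<sigma>" "apply_seq \<G> \<sigma> = Some \<H>" "derivation_R L \<H> \<tau> a \<K>"
  shows "derivation_R L \<G> (\<sigma> @ \<tau>) a \<K>"
  using assms unfolding derivation_R_def
  by (auto simp: struct_seq_append apply_seq_append split: prod.splits)

section \<open>From ILS to IILS\<close>

text \<open>Logical rules that keep the atoms also keep the set of formula labels, so the block
  moves to their premises as it is. \<open>EmpL\<close>, \<open>StarL\<close> and
  \<open>WandR\<close> add an atom and need \<open>struct_seq_frame\<close>: its labels are
  \<open>Eps\<close>, the label of the principal formula, or eigenvariables fresh for
  \<open>\<H>\<close>, and none of these is created by the block.\<close>

lemma IILS_struct:
  assumes "IILS \<H> \<Gamma> \<Delta>"
    and "struct_seq (form_labels \<Gamma> \<union> form_labels \<Delta>) \<G> \<sigma>" "apply_seq \<G> \<sigma> = Some \<H>"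
  shows "IILS \<G> \<Gamma> \<Delta>"
  using assms
proof (induction arbitrary: \<G> \<sigma>)
  case (ident w1 p \<Gamma> w2 \<Delta> \<H>)
  then show ?case by (meson IILS.ident entails_R_eq_struct)
next
  case (BotL \<H> w \<Gamma> \<Delta>)
  show ?case by (rule IILS.BotL)
next
  case (TopR \<H> \<Gamma> w \<Delta>)
  show ?case by (rule IILS.TopR)
next
  case (EmpL w \<H> \<Gamma> \<Delta>)
  have "struct_seq (form_labels \<Gamma> \<union> form_labels \<Delta>) (\<G> \<union> {(Eps, w, Eps)}) \<sigma> \<and>
      apply_seq (\<G> \<union> {(Eps, w, Eps)}) \<sigma> = Some (\<H> \<union> {(Eps, w, Eps)})"
    by (intro struct_seq_frame[OF EmpL.prems]) auto
  then show ?case using EmpL.IH by (auto intro: IILS.EmpL)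
next
  case (EmpR \<Gamma> w \<Delta> \<H>)
  then show ?case by (meson IILS.EmpR entails_R_eq_struct)
next
  case (AndL \<H> \<Gamma> w A B \<Delta>)
  then show ?case by (auto intro!: IILS.AndL AndL.IH)
next
  case (AndR \<H> \<Gamma> w A \<Delta> B)
  then show ?case by (auto intro!: IILS.AndR)
next
  case (ImpL \<H> \<Gamma> w A \<Delta> B)
  then show ?case by (auto intro!: IILS.ImpL)
next
  case (ImpR \<H> w A \<Gamma> B \<Delta>)
  then show ?case by (auto intro!: IILS.ImpR)
next
  case (StarL x y z \<H> \<Gamma> A B \<Delta>)
  \<comment> \<open>Eigenvariables fresh for \<open>\<H>\<close> are thereby fresh for the smaller
    set \<open>\<G>\<close>.\<close>
  have sub: "rel_labels \<G> \<subseteq> rel_labels \<H>"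
    using apply_seq_struct_mono[OF StarL.prems] rel_labels_mono by blast
  have "struct_seq (form_labels (\<Gamma> + {#(x, A), (y, B)#}) \<union> form_labels \<Delta>) (\<G> \<union> {(x, y, z)}) \<sigma> \<and>
      apply_seq (\<G> \<union> {(x, y, z)}) \<sigma> = Some (\<H> \<union> {(x, y, z)})"
    using StarL.hyps by (intro struct_seq_frame[OF StarL.prems]) (auto simp: fresh_def)
  then have "IILS (insert (x, y, z) \<G>) (\<Gamma> + {#(x, A), (y, B)#}) \<Delta>"
    using StarL.IH by auto
  then show ?case by (rule IILS.StarL) (use StarL.hyps sub in \<open>auto simp: fresh_def\<close>)
next
  case (WandR x y z \<H> A \<Gamma> B \<Delta>)
  have sub: "rel_labels \<G> \<subseteq> rel_labels \<H>"
    using apply_seq_struct_mono[OF WandR.prems] rel_labels_mono by blast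
  have "struct_seq (form_labels (add_mset (x, A) \<Gamma>) \<union> form_labels (add_mset (z, B) \<Delta>))
        (\<G> \<union> {(x, y, z)}) \<sigma> \<and>
      apply_seq (\<G> \<union> {(x, y, z)}) \<sigma> = Some (\<H> \<union> {(x, y, z)})"
    using WandR.hyps by (intro struct_seq_frame[OF WandR.prems]) (auto simp: fresh_def)
  then have "IILS (insert (x, y, z) \<G>) (add_mset (x, A) \<Gamma>) (add_mset (z, B) \<Delta>)"
    using WandR.IH by auto
  then show ?case by (rule IILS.WandR) (use WandR.hyps sub in \<open>auto simp: fresh_def\<close>)
next
  case (StarR \<Gamma> w A B \<Delta> \<H> \<tau> x y \<K>)
  show ?case
    by (rule IILS.StarR[OF derivation_R_struct]) (use StarR in auto)
next
  case (WandL w A B \<Gamma> \<Delta> \<H> \<tau> x z \<K>)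
  show ?case
    by (rule IILS.WandL[OF derivation_R_struct]) (use WandL in auto)
qed

lemma rels_simps [simp]:
  "rels (add_mset (Rel a) \<Gamma>) = insert a (rels \<Gamma>)"
  "rels (add_mset (Fm b) \<Gamma>) = rels \<Gamma>"
  unfolding rels_def by auto

lemma forms_simps [simp]:
  "forms (add_mset (Rel a) \<Gamma>) = forms \<Gamma>"
  "forms (add_mset (Fm b) \<Gamma>) = add_mset b (forms \<Gamma>)"
  unfolding forms_def by auto

lemma IILS_struct_step:
  assumes "IILS (\<G> \<union> introduced r) \<Gamma> \<Delta>"
    and "struct_inst (form_labels \<Gamma> \<union> form_labels \<Delta>) \<G> r" "principal r \<subseteq> \<G>"
  shows "IILS \<G> \<Gamma> \<Delta>"
  by (rule IILS_struct[OF assms(1), of _ "[r]"]) (use assms apply_inst_struct in auto)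

text \<open>Logical rules of ILS become instances of IILS rules, with the empty sequence wherever a
  derivation is required; the four structural rules are eliminated by
  \<open>IILS_struct_step\<close>.\<close>

lemma IILS_if_ILS: "ILS \<Gamma> \<Delta> \<Longrightarrow> IILS (rels \<Gamma>) (forms \<Gamma>) \<Delta>"
proof (induction rule: ILS.induct)
  case (ident w1 p \<Gamma> w2 \<Delta>)
  have "entails_R_eq L (rels \<Gamma>) w1 w2" for L
    unfolding entails_R_eq_def using ident by (intro exI[of _ "[]"]) auto
  then show ?case by (auto intro: IILS.ident)
next
  case (EmpR \<Gamma> w \<Delta>)
  have "entails_R_eq L (rels \<Gamma>) w Eps" for L
    unfolding entails_R_eq_def using EmpR by (intro exI[of _ "[]"]) auto
  then show ?case by (auto intro: IILS.EmpR)
next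
  case (StarL \<Gamma> x y z A B \<Delta>)
  show ?case
    using StarL by (auto intro!: IILS.StarL[of x y z] simp: labels_def)
next
  case (WandR \<Gamma> x y z A B \<Delta>)
  show ?case
    using WandR by (auto intro!: IILS.WandR[of x y z] simp: labels_def)
next
  case (StarR x y z' \<Gamma> \<Delta> A z B)
  \<comment> \<open>The principal atom witnesses the entailment: its first two labels match by
    reflexivity, the third by the side condition.\<close>
  have "derivation_R L (rels (add_mset (Rel (x, y, z')) \<Gamma>)) [] (x, y, z)
      (rels (add_mset (Rel (x, y, z')) \<Gamma>))" for L
    using StarR.hyps by (auto simp: derivation_R_def entails_E_iff)
  then show ?case by (rule IILS.StarR) (use StarR.IH in auto)
next
  case (WandL \<Gamma> x y' z y A B \<Delta>)
  have "derivation_R L (rels (\<Gamma> + {#Rel (x, y', z), Fm (y, Wand A B)#})) [] (x, y, z)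
      (rels (\<Gamma> + {#Rel (x, y', z), Fm (y, Wand A B)#}))" for L
    using WandL.hyps by (auto simp: derivation_R_def entails_E_iff)
  from IILS.WandL[OF this, of A B "forms \<Gamma>" \<Delta>] show ?case
    using WandL.IH by (auto simp: add_mset_commute)
next
  case (E \<Gamma> y x z \<Delta>)
  show ?case
    by (rule IILS_struct_step[of _ "RE x y z"]) (use E.IH in \<open>auto simp: insert_commute\<close>)
next
  case (U x \<Gamma> \<Delta>)
  show ?case
    by (rule IILS_struct_step[of _ "RU x"]) (use U.IH in auto)
next
  case (A \<Gamma> u w z y v x x' \<Delta>)
  show ?case
    by (rule IILS_struct_step[of _ "RA x y z u v x' w"])
      (use A.IH A.hyps in \<open>auto simp: insert_commute labels_def Un_ac\<close>)
next
  case (AC \<Gamma> x w x' y \<Delta>)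
  show ?case
    by (rule IILS_struct_step[of _ "RAC x y x' w"])
      (use AC.IH AC.hyps in \<open>auto simp: insert_commute labels_def Un_ac\<close>)
qed (auto intro: IILS.intros)

section \<open>From IILS to ILS\<close>

lemma rels_plus [simp]: "rels (\<Gamma> + \<Gamma>') = rels \<Gamma> \<union> rels \<Gamma>'"
  unfolding rels_def by auto

lemma rels_empty [simp]: "rels {#} = {}"
  unfolding rels_def by simp

lemma forms_plus [simp]: "forms (\<Gamma> + \<Gamma>') = forms \<Gamma> + forms \<Gamma>'"
  unfolding forms_def by simp

lemma forms_empty [simp]: "forms {#} = {#}"
  unfolding forms_def by simp

lemma rels_mem_split:
  assumes "a \<in> rels \<Gamma>"
  obtains \<Gamma>' where "\<Gamma> = add_mset (Rel a) \<Gamma>'"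
  using assms unfolding rels_def by (auto dest: multi_member_split)

lemma forms_add_split:
  assumes "forms \<Gamma> = add_mset a M"
  obtains \<Gamma>' where "\<Gamma> = add_mset (Fm a) \<Gamma>'" "forms \<Gamma>' = M"
proof -
  have "a \<in># forms \<Gamma>" using assms by simp
  then have "Fm a \<in># \<Gamma>" unfolding forms_def by auto
  then obtain \<Gamma>' where "\<Gamma> = add_mset (Fm a) \<Gamma>'" by (blast dest: multi_member_split)
  with assms that show thesis by simp
qed

section \<open>Simulation of sequents up to provable equality of labels\<close>

definition sim_form :: "rel set \<Rightarrow> 'p lform \<Rightarrow> 'p lform \<Rightarrow> bool" where
  "sim_form \<G> a b \<longleftrightarrow> eq_closure \<G> (fst a) (fst b) \<and> snd a = snd b"

lemma sim_form_pair [simp]: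
  "sim_form \<G> (x, A) (y, B) \<longleftrightarrow> eq_closure \<G> x y \<and> A = B"
  unfolding sim_form_def by simp

lemma rel_mset_sim_mono:
  "rel_mset (sim_form \<G>) M N \<Longrightarrow> \<G> \<subseteq> \<H> \<Longrightarrow> rel_mset (sim_form \<H>) M N"
  by (erule multiset.rel_mono_strong) (auto simp: sim_form_def intro: eq_closure_mono)

lemma rel_mset_simL:
  assumes "rel_mset (sim_form \<G>) (add_mset (x, A) M) N"
  obtains y N' where "N = add_mset (y, A) N'" "eq_closure \<G> x y" "rel_mset (sim_form \<G>) M N'"
  using msed_rel_invL[OF assms] by (auto simp: sim_form_def)

text \<open>The condition on labels makes every label that is fresh for the simulated sequent fresh for
  the simulating one.\<close>

definition sim ::
    "rel set \<Rightarrow> 'p lform multiset \<Rightarrow> 'p lform multiset \<Rightarrow>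
     'p entry multiset \<Rightarrow> 'p lform multiset \<Rightarrow> bool" where
  "sim \<G> \<Gamma> \<Delta> \<Gamma>' \<Delta>' \<longleftrightarrow> covers (rels \<Gamma>') \<G> \<and>
     rel_mset (sim_form (rels \<Gamma>')) \<Gamma> (forms \<Gamma>') \<and> rel_mset (sim_form (rels \<Gamma>')) \<Delta> \<Delta>' \<and>
     labels \<Gamma>' \<Delta>' \<subseteq> insert Eps (rel_labels \<G> \<union> form_labels \<Gamma> \<union> form_labels \<Delta>)"

lemma sim_refl: "sim (rels \<Gamma>) (forms \<Gamma>) \<Delta> \<Gamma> \<Delta>"
  unfolding sim_def
  by (auto simp: covers_subset labels_def sim_form_def intro: multiset.rel_refl)

lemma sim_fresh:
  assumes "sim \<G> \<Gamma> \<Delta> \<Gamma>' \<Delta>'" "fresh w (rel_labels \<G> \<union> form_labels \<Gamma> \<union> form_labels \<Delta>)"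
  shows "fresh w (labels \<Gamma>' \<Delta>')"
  using assms unfolding sim_def fresh_def by auto

lemma sim_leftE:
  assumes "sim \<G> (add_mset (x, A) \<Gamma>) \<Delta> \<Gamma>' \<Delta>'"
  obtains y \<Gamma>'' where "\<Gamma>' = add_mset (Fm (y, A)) \<Gamma>''" "eq_closure (rels \<Gamma>'') x y"
    "rel_mset (sim_form (rels \<Gamma>'')) \<Gamma> (forms \<Gamma>'')"
  using assms unfolding sim_def by (auto elim!: rel_mset_simL forms_add_split)

lemma sim_rightE:
  assumes "sim \<G> \<Gamma> (add_mset (x, A) \<Delta>) \<Gamma>' \<Delta>'"
  obtains y \<Delta>'' where "\<Delta>' = add_mset (y, A) \<Delta>''" "eq_closure (rels \<Gamma>') x y"
    "rel_mset (sim_form (rels \<Gamma>')) \<Delta> \<Delta>''"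
  using assms unfolding sim_def by (auto elim!: rel_mset_simL)

section \<open>Replaying structural rules in a simulating sequent\<close>

lemma sim_add_rels:
  assumes "sim \<G> \<Gamma> \<Delta> \<Gamma>' \<Delta>'" "forms \<X> = {#}"
    and "covers (rels \<Gamma>' \<union> rels \<X>) \<H>"
    and "rel_labels \<G> \<union> rel_labels (rels \<X>) \<subseteq>
      insert Eps (rel_labels \<H> \<union> form_labels \<Gamma> \<union> form_labels \<Delta>)"
  shows "sim \<H> \<Gamma> \<Delta> (\<Gamma>' + \<X>) \<Delta>'"
  using assms unfolding sim_def
  by (auto simp: labels_def intro: rel_mset_sim_mono)

text \<open>Apart from one coincidence in case \<open>RA\<close>, the same rule is applied to the
  counterparts of the principal atoms, with the same created label, which is fresh by
  \<open>sim_fresh\<close>. The new entries \<open>\<X>\<close> match the introduced atoms, and the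
  implication is this rule read from premise to conclusion.\<close>

lemma sim_struct_inst:
  assumes s: "sim \<G> \<Gamma> \<Delta> \<Gamma>' \<Delta>'"
    and r: "struct_inst (form_labels \<Gamma> \<union> form_labels \<Delta>) \<G> r" "principal r \<subseteq> \<G>"
  shows "\<exists>\<X>. sim (\<G> \<union> introduced r) \<Gamma> \<Delta> (\<Gamma>' + \<X>) \<Delta>' \<and>
    (ILS (\<Gamma>' + \<X>) \<Delta>' \<longrightarrow> ILS \<Gamma>' \<Delta>')"
proof -
  have cov: "covers (rels \<Gamma>') \<G>" using s unfolding sim_def by blast
  have cov': "covers (rels \<Gamma>' \<union> \<Y>) \<G>" for \<Y>
    using cov by (rule covers_mono) blast
  have lab: "rel_labels (rels \<Gamma>') \<subseteq> insert Eps (rel_labels \<G> \<union> form_labels \<Gamma> \<union> form_labels \<Delta>)"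
    using s unfolding sim_def labels_def by blast
  show ?thesis
  proof (cases r)
    case (RE x y z)
    with r obtain x' y' z' where im: "(x', y', z') \<in> rels \<Gamma>'" "eq_closure (rels \<Gamma>') x x'"
      "eq_closure (rels \<Gamma>') y y'" "eq_closure (rels \<Gamma>') z z'"
      using coversE[OF cov] by (metis insert_subset principal.simps(1))
    let ?X = "{#Rel (y', x', z')#}"
    from im(1) obtain \<Gamma>'' where \<Gamma>': "\<Gamma>' = add_mset (Rel (x', y', z')) \<Gamma>''"
      by (rule rels_mem_split)
    have "ILS (\<Gamma>' + ?X) \<Delta>' \<Longrightarrow> ILS \<Gamma>' \<Delta>'"
      unfolding \<Gamma>' by (rule ILS.E) (simp add: add_mset_commute)
    moreover have "sim (\<G> \<union> introduced r) \<Gamma> \<Delta> (\<Gamma>' + ?X) \<Delta>'"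
    proof (rule sim_add_rels[OF s])
      have "covers (rels \<Gamma>' \<union> rels ?X) (insert (y, x, z) \<G>)"
        by (rule covers_insert[OF cov']) (use im in \<open>auto intro: eq_closure_mono\<close>)
      then show "covers (rels \<Gamma>' \<union> rels ?X) (\<G> \<union> introduced r)"
        using RE by simp
    qed (use im(1) rel_labels_mono[of "{(x', y', z')}" "rels \<Gamma>'"] lab RE in auto)
    ultimately show ?thesis by (intro exI[of _ ?X]) auto
  next
    case (RU x)
    let ?X = "{#Rel (x, Eps, x)#}"
    have "ILS (\<Gamma>' + ?X) \<Delta>' \<Longrightarrow> ILS \<Gamma>' \<Delta>'"
      by (rule ILS.U[of x]) simp
    moreover have "sim (\<G> \<union> introduced r) \<Gamma> \<Delta> (\<Gamma>' + ?X) \<Delta>'"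
    proof (rule sim_add_rels[OF s])
      have "covers (rels \<Gamma>' \<union> rels ?X) (insert (x, Eps, x) \<G>)"
        by (rule covers_insert[OF cov']) auto
      then show "covers (rels \<Gamma>' \<union> rels ?X) (\<G> \<union> introduced r)"
        using RU by simp
    qed (use RU in auto)
    ultimately show ?thesis by (intro exI[of _ ?X]) auto
  next
    case (RA x y z u v x0 w)
    with r have ps: "(x, y, z) \<in> \<G>" "(u, v, x0) \<in> \<G>" and eq: "eq_closure \<G> x x0"
      and fr: "fresh w (rel_labels \<G> \<union> form_labels \<Gamma> \<union> form_labels \<Delta>)"
      by (auto simp: entails_E_iff Un_ac)
    from cov ps(1) obtain x' y' z' where im: "(x', y', z') \<in> rels \<Gamma>'"
      "eq_closure (rels \<Gamma>') x x'" "eq_closure (rels \<Gamma>') y y'" "eq_closure (rels \<Gamma>') z z'"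
      by (rule coversE)
    from cov ps(2) obtain u' v' x0' where im': "(u', v', x0') \<in> rels \<Gamma>'"
      "eq_closure (rels \<Gamma>') u u'" "eq_closure (rels \<Gamma>') v v'" "eq_closure (rels \<Gamma>') x0 x0'"
      by (rule coversE)
    \<comment> \<open>The chain is \<open>x'\<close>, \<open>x\<close>, \<open>x0\<close>,
      \<open>x0'\<close>; its middle equality is the side condition, carried over from
      \<open>\<G>\<close> by covering.\<close>
    have eq': "eq_closure (rels \<Gamma>') x' x0'"
      using eq_closure_covers[OF eq cov] im(2) im'(4) eq_closure.sym eq_closure.trans by blast
    have fr': "fresh w (labels \<Gamma>' \<Delta>')" using s fr by (rule sim_fresh)
    let ?X = "{#Rel (u', w, z'), Rel (y', v', w)#}"
    have "ILS \<Gamma>' \<Delta>'" if prem: "ILS (\<Gamma>' + ?X) \<Delta>'"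
    proof (cases "(x', y', z') = (u', v', x0')")
      text \<open>A single atom plays both roles, whereas \<open>A\<close> of ILS needs two occurrences.\<close>
      case True
      from im(1) obtain \<Gamma>'' where \<Gamma>': "\<Gamma>' = add_mset (Rel (x', y', z')) \<Gamma>''"
        by (rule rels_mem_split)
      \<comment> \<open>Since \<open>u' = x'\<close> and \<open>v' = y'\<close>, the atoms of
        \<open>?X\<close> are \<open>(x', w, z')\<close> and \<open>(y', y', w)\<close>, exactly
        those that \<open>ILS.AC\<close> adds; \<open>x0' = z'\<close> turns \<open>eq'\<close> into
        its side condition.\<close>
      show ?thesis
        using prem eq' fr' True unfolding \<Gamma>'
        by (intro ILS.AC[of \<Gamma>'' x' w z' y']) (auto simp: entails_E_iff add_mset_commute)
    next
      case False
      from im(1) obtain \<Gamma>1 where \<Gamma>1: "\<Gamma>' = add_mset (Rel (x', y', z')) \<Gamma>1"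
        by (rule rels_mem_split)
      with im'(1) False have "(u', v', x0') \<in> rels \<Gamma>1" by auto
      then obtain \<Gamma>'' where \<Gamma>'': "\<Gamma>1 = add_mset (Rel (u', v', x0')) \<Gamma>''"
        by (rule rels_mem_split)
      have \<Gamma>': "\<Gamma>' = \<Gamma>'' + {#Rel (x', y', z'), Rel (u', v', x0')#}"
        unfolding \<Gamma>1 \<Gamma>'' by simp
      show ?thesis
        using prem eq' fr' unfolding \<Gamma>'
        by (intro ILS.A[of \<Gamma>'' u' w z' y' v' x' x0'])
          (simp_all add: entails_E_iff add_mset_commute)
    qed
    moreover have "sim (\<G> \<union> introduced r) \<Gamma> \<Delta> (\<Gamma>' + ?X) \<Delta>'"
    proof (rule sim_add_rels[OF s])
      have "covers (rels \<Gamma>' \<union> rels ?X) (insert (u, w, z) (insert (y, v, w) \<G>))"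
        by (rule covers_insert[where x' = u' and y' = w and z' = z',
            OF covers_insert[where x' = y' and y' = v' and z' = w, OF cov']])
          (use im im' in \<open>auto intro: eq_closure_mono\<close>)
      then show "covers (rels \<Gamma>' \<union> rels ?X) (\<G> \<union> introduced r)"
        using RA by (simp add: insert_commute)
    qed (use im(1) im'(1) rel_labels_mono[of "{(x', y', z'), (u', v', x0')}" "rels \<Gamma>'"] lab RA
         in auto)
    ultimately show ?thesis by (intro exI[of _ ?X]) auto
  next
    case (RAC x y x0 w)
    with r have ps: "(x, y, x0) \<in> \<G>" and eq: "eq_closure \<G> x x0"
      and fr: "fresh w (rel_labels \<G> \<union> form_labels \<Gamma> \<union> form_labels \<Delta>)"
      by (auto simp: entails_E_iff Un_ac)
    from cov ps(1) obtain x' y' x0' where im: "(x', y', x0') \<in> rels \<Gamma>'"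
      "eq_closure (rels \<Gamma>') x x'" "eq_closure (rels \<Gamma>') y y'" "eq_closure (rels \<Gamma>') x0 x0'"
      by (rule coversE)
    have eq': "eq_closure (rels \<Gamma>') x' x0'"
      using eq_closure_covers[OF eq cov] im(2,4) eq_closure.sym eq_closure.trans by blast
    have fr': "fresh w (labels \<Gamma>' \<Delta>')" using s fr by (rule sim_fresh)
    let ?X = "{#Rel (x', w, x0'), Rel (y', y', w)#}"
    from im(1) obtain \<Gamma>'' where \<Gamma>': "\<Gamma>' = add_mset (Rel (x', y', x0')) \<Gamma>''"
      by (rule rels_mem_split)
    have "ILS (\<Gamma>' + ?X) \<Delta>' \<Longrightarrow> ILS \<Gamma>' \<Delta>'"
      using eq' fr' unfolding \<Gamma>'
      by (intro ILS.AC[of \<Gamma>'' x' w x0' y']) (auto simp: entails_E_iff add_mset_commute)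
    moreover have "sim (\<G> \<union> introduced r) \<Gamma> \<Delta> (\<Gamma>' + ?X) \<Delta>'"
    proof (rule sim_add_rels[OF s])
      have "covers (rels \<Gamma>' \<union> rels ?X) (insert (x, w, x0) (insert (y, y, w) \<G>))"
        by (rule covers_insert[where x' = x' and y' = w and z' = x0',
            OF covers_insert[where x' = y' and y' = y' and z' = w, OF cov']])
          (use im in \<open>auto intro: eq_closure_mono\<close>)
      then show "covers (rels \<Gamma>' \<union> rels ?X) (\<G> \<union> introduced r)"
        using RAC by (simp add: insert_commute)
    qed (use im(1) rel_labels_mono[of "{(x', y', x0')}" "rels \<Gamma>'"] lab RAC in auto)
    ultimately show ?thesis by (intro exI[of _ ?X]) auto
  qed (use r in auto)
qed

lemma sim_struct_seq:
  assumes "sim \<G> \<Gamma> \<Delta> \<Gamma>' \<Delta>'"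
    and "struct_seq (form_labels \<Gamma> \<union> form_labels \<Delta>) \<G> \<sigma>" "apply_seq \<G> \<sigma> = Some \<H>"
  shows "\<exists>\<X>. sim \<H> \<Gamma> \<Delta> (\<Gamma>' + \<X>) \<Delta>' \<and>
    (ILS (\<Gamma>' + \<X>) \<Delta>' \<longrightarrow> ILS \<Gamma>' \<Delta>')"
  using assms
proof (induction \<sigma> arbitrary: \<G> \<Gamma>')
  case Nil
  then show ?case by (intro exI[of _ "{#}"]) auto
next
  case (Cons r \<sigma>)
  then have r: "struct_inst (form_labels \<Gamma> \<union> form_labels \<Delta>) \<G> r" "principal r \<subseteq> \<G>"
    and seq: "struct_seq (form_labels \<Gamma> \<union> form_labels \<Delta>) (apply_inst \<G> r) \<sigma>"
      "apply_seq (apply_inst \<G> r) \<sigma> = Some \<H>"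
    by (auto split: if_splits)
  from sim_struct_inst[OF Cons.prems(1) r] obtain \<X> where \<X>:
    "sim (apply_inst \<G> r) \<Gamma> \<Delta> (\<Gamma>' + \<X>) \<Delta>'" "ILS (\<Gamma>' + \<X>) \<Delta>' \<longrightarrow> ILS \<Gamma>' \<Delta>'"
    unfolding apply_inst_struct[OF r(1)] by blast
  from Cons.IH[OF \<X>(1) seq] obtain \<Y> where
    "sim \<H> \<Gamma> \<Delta> (\<Gamma>' + \<X> + \<Y>) \<Delta>'" "ILS (\<Gamma>' + \<X> + \<Y>) \<Delta>' \<longrightarrow> ILS (\<Gamma>' + \<X>) \<Delta>'"
    by blast
  with \<X> show ?case by (intro exI[of _ "\<X> + \<Y>"]) (auto simp: add.assoc)
qed

lemma sim_entails_R_eq: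
  assumes s: "sim \<G> \<Gamma> \<Delta> \<Gamma>' \<Delta>'"
    and ent: "entails_R_eq (form_labels \<Gamma> \<union> form_labels \<Delta>) \<G> u v"
  obtains \<H> \<X> where "sim \<H> \<Gamma> \<Delta> (\<Gamma>' + \<X>) \<Delta>'"
    "eq_closure (rels (\<Gamma>' + \<X>)) u v" "ILS (\<Gamma>' + \<X>) \<Delta>' \<longrightarrow> ILS \<Gamma>' \<Delta>'"
proof -
  from ent obtain \<sigma> \<H> where \<sigma>: "struct_seq (form_labels \<Gamma> \<union> form_labels \<Delta>) \<G> \<sigma>"
    "apply_seq \<G> \<sigma> = Some \<H>" and eq: "eq_closure \<H> u v"
    unfolding entails_R_eq_def entails_E_iff by blast
  from sim_struct_seq[OF s \<sigma>] obtain \<X> where \<X>: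
    "sim \<H> \<Gamma> \<Delta> (\<Gamma>' + \<X>) \<Delta>'" "ILS (\<Gamma>' + \<X>) \<Delta>' \<longrightarrow> ILS \<Gamma>' \<Delta>'"
    by blast
  from \<X>(1) have "covers (rels (\<Gamma>' + \<X>)) \<H>" unfolding sim_def by blast
  with eq have "eq_closure (rels (\<Gamma>' + \<X>)) u v" by (rule eq_closure_covers)
  with \<X> that show thesis by blast
qed

text \<open>After the replay, the atom of \<open>\<H>\<close> that witnesses the entailment has a
  counterpart among the entries of \<open>\<Gamma>' + \<X>\<close>. It is split off because it
  becomes the principal atom of \<open>ILS.StarR\<close> or \<open>ILS.WandL\<close>.\<close>

lemma sim_derivation_R:
  assumes s: "sim \<G> \<Gamma> \<Delta> \<Gamma>' \<Delta>'"
    and der: "derivation_R (form_labels \<Gamma> \<union> form_labels \<Delta>) \<G> \<sigma> (x, y, z) \<H>"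
  obtains \<X> \<Psi> x' y' z' where "sim \<H> \<Gamma> \<Delta> (\<Gamma>' + \<X>) \<Delta>'"
    "\<Gamma>' + \<X> = add_mset (Rel (x', y', z')) \<Psi>"
    "eq_closure (rels (\<Gamma>' + \<X>)) x x'" "eq_closure (rels (\<Gamma>' + \<X>)) y y'"
    "eq_closure (rels (\<Gamma>' + \<X>)) z z'" "ILS (\<Gamma>' + \<X>) \<Delta>' \<longrightarrow> ILS \<Gamma>' \<Delta>'"
proof -
  from der obtain x1 y1 z1 where \<sigma>: "struct_seq (form_labels \<Gamma> \<union> form_labels \<Delta>) \<G> \<sigma>"
    "apply_seq \<G> \<sigma> = Some \<H>" and atom: "(x1, y1, z1) \<in> \<H>"
    and eq: "eq_closure \<H> x x1" "eq_closure \<H> y y1" "eq_closure \<H> z z1"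
    unfolding derivation_R_def entails_E_iff by auto
  from sim_struct_seq[OF s \<sigma>] obtain \<X> where \<X>:
    "sim \<H> \<Gamma> \<Delta> (\<Gamma>' + \<X>) \<Delta>'" "ILS (\<Gamma>' + \<X>) \<Delta>' \<longrightarrow> ILS \<Gamma>' \<Delta>'"
    by blast
  from \<X>(1) have cov: "covers (rels (\<Gamma>' + \<X>)) \<H>" unfolding sim_def by blast
  from cov atom obtain x' y' z' where im: "(x', y', z') \<in> rels (\<Gamma>' + \<X>)"
    "eq_closure (rels (\<Gamma>' + \<X>)) x1 x'" "eq_closure (rels (\<Gamma>' + \<X>)) y1 y'"
    "eq_closure (rels (\<Gamma>' + \<X>)) z1 z'"
    by (rule coversE)
  from im(1) obtain \<Psi> where "\<Gamma>' + \<X> = add_mset (Rel (x', y', z')) \<Psi>"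
    by (rule rels_mem_split)
  then show thesis
    using \<X>(2)
    by (intro that[OF \<X>(1) _ eq_closure.trans[OF eq_closure_covers[OF eq(1) cov] im(2)]
          eq_closure.trans[OF eq_closure_covers[OF eq(2) cov] im(3)]
          eq_closure.trans[OF eq_closure_covers[OF eq(3) cov] im(4)]])
qed

section \<open>Simulating the logical rules\<close>

lemma rel_mset_sim_add:
  "rel_mset (sim_form \<G>) M N \<Longrightarrow> eq_closure \<G> x y \<Longrightarrow>
   rel_mset (sim_form \<G>) (add_mset (x, A) M) (add_mset (y, A) N)"
  by (rule rel_mset_Plus) auto

text \<open>The new formula may carry different, provably equal labels on the two sides. As
  \<open>y\<close> already occurs in an atom, the simulating sequent gains no label and the bound on
  its labels survives.\<close>

lemma sim_add_right:
  assumes "sim \<G> \<Gamma> \<Delta> \<Gamma>' \<Delta>'" "eq_closure (rels \<Gamma>') x y" "y \<in> rel_labels (rels \<Gamma>')"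
  shows "sim \<G> \<Gamma> (add_mset (x, A) \<Delta>) \<Gamma>' (add_mset (y, A) \<Delta>')"
  using assms unfolding sim_def by (auto simp: labels_def rel_mset_sim_add)

lemma sim_add_left:
  assumes "sim \<G> \<Gamma> \<Delta> \<Gamma>' \<Delta>'" "eq_closure (rels \<Gamma>') x y" "y \<in> rel_labels (rels \<Gamma>')"
  shows "sim \<G> (add_mset (x, A) \<Gamma>) \<Delta> (add_mset (Fm (y, A)) \<Gamma>') \<Delta>'"
  using assms unfolding sim_def by (auto simp: labels_def rel_mset_sim_add)

text \<open>The simulating sequent varies in the induction because premises of \<open>StarR\<close>
  and \<open>WandL\<close> are simulated with labels of the ILS principal atom in place of those
  named by the IILS rule. Derivations are replayed first, after which the corresponding ILS rule
  applies.\<close>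

lemma ILS_if_sim_IILS:
  assumes "IILS \<G> \<Gamma> \<Delta>" "sim \<G> \<Gamma> \<Delta> \<Gamma>' \<Delta>'"
  shows "ILS \<Gamma>' \<Delta>'"
  using assms
proof (induction arbitrary: \<Gamma>' \<Delta>')
  case (ident w1 p \<Gamma> w2 \<Delta> \<G>)
  obtain \<H> \<X> where
    s: "sim \<H> (add_mset (w1, Atom p) \<Gamma>) (add_mset (w2, Atom p) \<Delta>) (\<Gamma>' + \<X>) \<Delta>'"
    and eq: "eq_closure (rels (\<Gamma>' + \<X>)) w1 w2" and step: "ILS (\<Gamma>' + \<X>) \<Delta>' \<longrightarrow> ILS \<Gamma>' \<Delta>'"
    by (rule sim_entails_R_eq[OF ident.prems ident.hyps])
  obtain y1 \<Gamma>'' where l: "\<Gamma>' + \<X> = add_mset (Fm (y1, Atom p)) \<Gamma>''" "eq_closure (rels \<Gamma>'') w1 y1"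
    using s by (rule sim_leftE)
  obtain y2 \<Delta>'' where r: "\<Delta>' = add_mset (y2, Atom p) \<Delta>''" "eq_closure (rels (\<Gamma>' + \<X>)) w2 y2"
    using s by (rule sim_rightE)
  \<comment> \<open>The chain is \<open>y1\<close>, \<open>w1\<close>, \<open>w2\<close>,
    \<open>y2\<close>; its middle equality holds once the structural rules have been
    replayed.\<close>
  have "eq_closure (rels \<Gamma>'') y1 y2"
    using l(2) eq r(2) eq_closure.sym eq_closure.trans unfolding l(1) rels_simps by blast
  then show ?case
    unfolding r(1) using step[unfolded l(1) r(1)] by (simp add: ILS.ident entails_E_iff)
next
  case (BotL \<G> w \<Gamma> \<Delta>)
  then show ?case by (elim sim_leftE) (simp add: ILS.BotL)
next
  case (TopR \<G> \<Gamma> w \<Delta>)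
  then show ?case by (elim sim_rightE) (simp add: ILS.TopR)
next
  case (EmpL w \<G> \<Gamma> \<Delta>)
  from EmpL.prems obtain y \<Gamma>'' where l: "\<Gamma>' = add_mset (Fm (y, Emp)) \<Gamma>''"
    "eq_closure (rels \<Gamma>'') w y" "rel_mset (sim_form (rels \<Gamma>'')) \<Gamma> (forms \<Gamma>'')"
    by (rule sim_leftE)
  have "covers (rels (add_mset (Rel (Eps, y, Eps)) \<Gamma>'')) (insert (Eps, w, Eps) \<G>)"
  proof (rule covers_insert)
    show "covers (rels (add_mset (Rel (Eps, y, Eps)) \<Gamma>'')) \<G>"
      using EmpL.prems unfolding sim_def l(1) by (auto elim: covers_mono)
  qed (use l(2) in \<open>auto intro: eq_closure_mono\<close>)
  then have "sim (insert (Eps, w, Eps) \<G>) \<Gamma> \<Delta> (add_mset (Rel (Eps, y, Eps)) \<Gamma>'') \<Delta>'"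
    using EmpL.prems l(3) unfolding sim_def l(1)
    by (auto simp: labels_def intro: rel_mset_sim_mono)
  then show ?case unfolding l(1) by (intro ILS.EmpL EmpL.IH)
next
  case (EmpR \<Gamma> w \<Delta> \<G>)
  obtain \<H> \<X> where
    s: "sim \<H> \<Gamma> (add_mset (w, Emp) \<Delta>) (\<Gamma>' + \<X>) \<Delta>'"
    and eq: "eq_closure (rels (\<Gamma>' + \<X>)) w Eps" and step: "ILS (\<Gamma>' + \<X>) \<Delta>' \<longrightarrow> ILS \<Gamma>' \<Delta>'"
    by (rule sim_entails_R_eq[OF EmpR.prems EmpR.hyps])
  obtain y \<Delta>'' where r: "\<Delta>' = add_mset (y, Emp) \<Delta>''" "eq_closure (rels (\<Gamma>' + \<X>)) w y"
    using s by (rule sim_rightE)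
  have "eq_closure (rels (\<Gamma>' + \<X>)) y Eps"
    using eq r(2) eq_closure.sym eq_closure.trans by blast
  then have "ILS (\<Gamma>' + \<X>) \<Delta>'" unfolding r(1) by (intro ILS.EmpR) (simp add: entails_E_iff)
  with step show ?case by (rule mp)
next
  case (AndL \<G> \<Gamma> w A B \<Delta>)
  from AndL.prems obtain y \<Gamma>'' where l: "\<Gamma>' = add_mset (Fm (y, And A B)) \<Gamma>''"
    "eq_closure (rels \<Gamma>'') w y" "rel_mset (sim_form (rels \<Gamma>'')) \<Gamma> (forms \<Gamma>'')"
    by (rule sim_leftE)
  have "sim \<G> (\<Gamma> + {#(w, A), (w, B)#}) \<Delta> (\<Gamma>'' + {#Fm (y, A), Fm (y, B)#}) \<Delta>'"
    using AndL.prems l(2,3) unfolding sim_def l(1)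
    by (auto simp: labels_def rel_mset_sim_add)
  then show ?case unfolding l(1) by (intro ILS.AndL AndL.IH)
next
  case (AndR \<G> \<Gamma> w A \<Delta> B)
  from AndR.prems obtain y \<Delta>'' where r: "\<Delta>' = add_mset (y, And A B) \<Delta>''"
    "eq_closure (rels \<Gamma>') w y" "rel_mset (sim_form (rels \<Gamma>')) \<Delta> \<Delta>''"
    by (rule sim_rightE)
  have "sim \<G> \<Gamma> (add_mset (w, C) \<Delta>) \<Gamma>' (add_mset (y, C) \<Delta>'')" for C
    using AndR.prems r(2,3) unfolding sim_def r(1)
    by (auto simp: labels_def rel_mset_sim_add)
  then show ?case unfolding r(1) by (intro ILS.AndR AndR.IH)
next
  case (ImpL \<G> \<Gamma> w A \<Delta> B)
  from ImpL.prems obtain y \<Gamma>'' where l: "\<Gamma>' = add_mset (Fm (y, Imp A B)) \<Gamma>''"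
    "eq_closure (rels \<Gamma>'') w y" "rel_mset (sim_form (rels \<Gamma>'')) \<Gamma> (forms \<Gamma>'')"
    by (rule sim_leftE)
  have "sim \<G> \<Gamma> (add_mset (w, A) \<Delta>) \<Gamma>'' (add_mset (y, A) \<Delta>')"
    "sim \<G> (add_mset (w, B) \<Gamma>) \<Delta> (add_mset (Fm (y, B)) \<Gamma>'') \<Delta>'"
    using ImpL.prems l(2,3) unfolding sim_def l(1)
    by (auto simp: labels_def rel_mset_sim_add)
  then show ?case unfolding l(1) by (intro ILS.ImpL ImpL.IH)
next
  case (ImpR \<G> w A \<Gamma> B \<Delta>)
  from ImpR.prems obtain y \<Delta>'' where r: "\<Delta>' = add_mset (y, Imp A B) \<Delta>''"
    "eq_closure (rels \<Gamma>') w y" "rel_mset (sim_form (rels \<Gamma>')) \<Delta> \<Delta>''"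
    by (rule sim_rightE)
  have "sim \<G> (add_mset (w, A) \<Gamma>) (add_mset (w, B) \<Delta>)
      (add_mset (Fm (y, A)) \<Gamma>') (add_mset (y, B) \<Delta>'')"
    using ImpR.prems r(2,3) unfolding sim_def r(1)
    by (auto simp: labels_def rel_mset_sim_add)
  then show ?case unfolding r(1) by (intro ILS.ImpR ImpR.IH)
next
  case (StarL x y z \<G> \<Gamma> A B \<Delta>)
  from StarL.prems obtain z' \<Gamma>'' where l: "\<Gamma>' = add_mset (Fm (z', Star A B)) \<Gamma>''"
    "eq_closure (rels \<Gamma>'') z z'" "rel_mset (sim_form (rels \<Gamma>'')) \<Gamma> (forms \<Gamma>'')"
    by (rule sim_leftE)
  \<comment> \<open>The eigenvariables \<open>x\<close> and \<open>y\<close> are kept; only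
    \<open>z\<close> becomes \<open>z'\<close>, the label of the simulating formula.\<close>
  let ?\<Gamma> = "\<Gamma>'' + {#Rel (x, y, z'), Fm (x, A), Fm (y, B)#}"
  have "covers (rels ?\<Gamma>) (insert (x, y, z) \<G>)"
  proof (rule covers_insert)
    show "covers (rels ?\<Gamma>) \<G>"
      using StarL.prems unfolding sim_def l(1) by (auto elim: covers_mono)
    show "(x, y, z') \<in> rels ?\<Gamma>" by simp
  qed (use l(2) in \<open>auto intro: eq_closure_mono\<close>)
  moreover have "rel_mset (sim_form (rels ?\<Gamma>)) (\<Gamma> + {#(x, A), (y, B)#}) (forms ?\<Gamma>)"
    using l(3) by (auto intro!: rel_mset_sim_add intro: rel_mset_sim_mono)
  moreover have "rel_mset (sim_form (rels ?\<Gamma>)) \<Delta> \<Delta>'"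
    using StarL.prems unfolding sim_def l(1) by (auto intro: rel_mset_sim_mono)
  ultimately have "sim (insert (x, y, z) \<G>) (\<Gamma> + {#(x, A), (y, B)#}) \<Delta> ?\<Gamma> \<Delta>'"
    using StarL.prems unfolding sim_def l(1) by (auto simp: labels_def)
  then have "ILS ?\<Gamma> \<Delta>'" by (rule StarL.IH)
  then show ?case
    unfolding l(1)
    by (rule ILS.StarL)
      (use StarL.hyps sim_fresh[OF StarL.prems] in \<open>auto simp: l(1)\<close>)
next
  case (WandR x y z \<G> A \<Gamma> B \<Delta>)
  from WandR.prems obtain y' \<Delta>'' where r: "\<Delta>' = add_mset (y', Wand A B) \<Delta>''"
    "eq_closure (rels \<Gamma>') y y'" "rel_mset (sim_form (rels \<Gamma>')) \<Delta> \<Delta>''"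
    by (rule sim_rightE)
  let ?\<Gamma> = "\<Gamma>' + {#Rel (x, y', z), Fm (x, A)#}" and ?\<Delta> = "add_mset (z, B) \<Delta>''"
  have "covers (rels ?\<Gamma>) (insert (x, y, z) \<G>)"
  proof (rule covers_insert)
    show "covers (rels ?\<Gamma>) \<G>"
      using WandR.prems unfolding sim_def by (auto elim: covers_mono)
    show "(x, y', z) \<in> rels ?\<Gamma>" by simp
  qed (use r(2) in \<open>auto intro: eq_closure_mono\<close>)
  moreover have "rel_mset (sim_form (rels ?\<Gamma>)) (add_mset (x, A) \<Gamma>) (forms ?\<Gamma>)"
    using WandR.prems unfolding sim_def
    by (auto intro!: rel_mset_sim_add intro: rel_mset_sim_mono)
  moreover have "rel_mset (sim_form (rels ?\<Gamma>)) (add_mset (z, B) \<Delta>) ?\<Delta>"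
    using r(3) by (auto intro!: rel_mset_sim_add intro: rel_mset_sim_mono)
  ultimately have "sim (insert (x, y, z) \<G>) (add_mset (x, A) \<Gamma>) (add_mset (z, B) \<Delta>) ?\<Gamma> ?\<Delta>"
    using WandR.prems unfolding sim_def r(1) by (auto simp: labels_def)
  then have "ILS ?\<Gamma> ?\<Delta>" by (rule WandR.IH)
  then show ?case
    unfolding r(1)
    by (rule ILS.WandR)
      (use WandR.hyps sim_fresh[OF WandR.prems] in \<open>auto simp: r(1)\<close>)
next
  case (StarR \<Gamma> w A B \<Delta> \<G> \<sigma> x y \<H>)
  obtain \<X> \<Psi> x' y' w' where
    s: "sim \<H> \<Gamma> (add_mset (w, Star A B) \<Delta>) (\<Gamma>' + \<X>) \<Delta>'"
    and \<Psi>: "\<Gamma>' + \<X> = add_mset (Rel (x', y', w')) \<Psi>"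
    and eq: "eq_closure (rels (\<Gamma>' + \<X>)) x x'" "eq_closure (rels (\<Gamma>' + \<X>)) y y'"
      "eq_closure (rels (\<Gamma>' + \<X>)) w w'"
    and step: "ILS (\<Gamma>' + \<X>) \<Delta>' \<longrightarrow> ILS \<Gamma>' \<Delta>'"
    by (rule sim_derivation_R[OF StarR.prems StarR.hyps(1)])
  from s obtain w'' \<Delta>'' where r: "\<Delta>' = add_mset (w'', Star A B) \<Delta>''"
    "eq_closure (rels (\<Gamma>' + \<X>)) w w''"
    by (rule sim_rightE)
  have lab: "x' \<in> rel_labels (rels (\<Gamma>' + \<X>))" "y' \<in> rel_labels (rels (\<Gamma>' + \<X>))"
    unfolding \<Psi> by auto
  have "ILS (\<Gamma>' + \<X>) \<Delta>'"
    unfolding \<Psi> r(1)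
  proof (rule ILS.StarR)
    \<comment> \<open>The IILS premise labels \<open>A\<close> with \<open>x\<close>, the ILS rule
      with the label \<open>x'\<close> of its atom; the induction hypothesis allows this
      replacement.\<close>
    show "ILS (add_mset (Rel (x', y', w')) \<Psi>) (\<Delta>'' + {#(x', A), (w'', Star A B)#})"
      using StarR.IH(1) sim_add_right[OF s eq(1) lab(1)] unfolding \<Psi> r(1) by auto
    show "ILS (add_mset (Rel (x', y', w')) \<Psi>) (\<Delta>'' + {#(y', B), (w'', Star A B)#})"
      using StarR.IH(2) sim_add_right[OF s eq(2) lab(2)] unfolding \<Psi> r(1) by auto
    \<comment> \<open>The label \<open>w''\<close> of the formula and the label \<open>w'\<close> of
      the atom are both equal to \<open>w\<close>.\<close>
    show "entails_E (rels (add_mset (Rel (x', y', w')) \<Psi>)) w'' w'"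
      using eq(3) r(2) eq_closure.sym eq_closure.trans unfolding \<Psi> entails_E_iff by blast
  qed
  with step show ?case by (rule mp)
next
  case (WandL w A B \<Gamma> \<Delta> \<G> \<sigma> x z \<H>)
  obtain \<X> \<Psi> x' w' z' where
    s: "sim \<H> (add_mset (w, Wand A B) \<Gamma>) \<Delta> (\<Gamma>' + \<X>) \<Delta>'"
    and \<Psi>: "\<Gamma>' + \<X> = add_mset (Rel (x', w', z')) \<Psi>"
    and eq: "eq_closure (rels (\<Gamma>' + \<X>)) x x'" "eq_closure (rels (\<Gamma>' + \<X>)) w w'"
      "eq_closure (rels (\<Gamma>' + \<X>)) z z'"
    and step: "ILS (\<Gamma>' + \<X>) \<Delta>' \<longrightarrow> ILS \<Gamma>' \<Delta>'"
    by (rule sim_derivation_R[OF WandL.prems WandL.hyps(1)])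
  from s obtain w'' \<Psi>' where l: "\<Gamma>' + \<X> = add_mset (Fm (w'', Wand A B)) \<Psi>'"
    "eq_closure (rels \<Psi>') w w''"
    by (rule sim_leftE)
  have w'': "eq_closure (rels (\<Gamma>' + \<X>)) w w''" using l(2) unfolding l(1) by simp
  \<comment> \<open>The two decompositions split off entries of different kinds, an atom and a
    formula, so both can be removed at once.\<close>
  from l(1) \<Psi> obtain \<Gamma>'' where
    \<Gamma>'': "\<Gamma>' + \<X> = \<Gamma>'' + {#Rel (x', w', z'), Fm (w'', Wand A B)#}"
    by (auto simp: add_eq_conv_ex add_mset_commute)
  have lab: "x' \<in> rel_labels (rels (\<Gamma>' + \<X>))" "z' \<in> rel_labels (rels (\<Gamma>' + \<X>))"
    unfolding \<Psi> by auto
  have "ILS (\<Gamma>' + \<X>) \<Delta>'"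
    unfolding \<Gamma>''
  proof (rule ILS.WandL)
    show "ILS (\<Gamma>'' + {#Rel (x', w', z'), Fm (w'', Wand A B)#}) (add_mset (x', A) \<Delta>')"
      using WandL.IH(1) sim_add_right[OF s eq(1) lab(1)] unfolding \<Gamma>'' by auto
    show "ILS (\<Gamma>'' + {#Rel (x', w', z'), Fm (w'', Wand A B), Fm (z', B)#}) \<Delta>'"
      using WandL.IH(2) sim_add_left[OF s eq(3) lab(2), of B] unfolding \<Gamma>''
      by (simp add: add_mset_commute)
    show "entails_E (rels (\<Gamma>'' + {#Rel (x', w', z'), Fm (w'', Wand A B)#})) w'' w'"
      using eq(2) w'' eq_closure.sym eq_closure.trans unfolding \<Gamma>'' entails_E_iff by blast
  qed
  with step show ?case by (rule mp)
qed

theorem theorem5: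
  fixes \<Gamma> :: "'p entry multiset" and \<Delta> :: "'p lform multiset"
  shows "ILS \<Gamma> \<Delta> \<longleftrightarrow> IILS (rels \<Gamma>) (forms \<Gamma>) \<Delta>"
  using IILS_if_ILS ILS_if_sim_IILS sim_refl by blast

end
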